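(* Let $m\ge 1$ be an integer and let $r=p/q$ be an irreducible $(m-1,m-1)$-rational function. Let $\theta_1,\ldots,\theta_{2m-1}\in\mathbb{R}$ be distinct nodes such that $$r(\theta_j)=\mathrm{e}^{\mathrm{i}\theta_j},\qquad j=1,\ldots,2m-1.$$ Then $r$ has no poles on the real axis and satisfies $|r(x)|=1$ for all $x\in\mathbb{R}$.
   Context: An $(m-1,m-1)$-rational function is a quotient $r=p/q$ where $p$ and $q$ are polynomials with complex coefficients, each of degree $\le m-1$ (with $q$ not the zero polynomial). It is called irreducible if $p$ and $q$ have no common (complex) zeros. The poles of $r$ are the zeros of $q$. Here $\mathrm{i}$ is the imaginary unit. *)

theory Defs
  imports Complex_Main "HOL-Computational_Algebra.Polynomial"
begin

text \<open>A rational function is given by its numerator and denominator.\<close>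

definition is_ratfun :: "nat \<Rightarrow> nat \<Rightarrow> complex poly \<Rightarrow> complex poly \<Rightarrow> bool" where
  "is_ratfun k l p q \<longleftrightarrow> degree p \<le> k \<and> degree q \<le> l \<and> q \<noteq> 0"

definition ratfun_irreducible :: "complex poly \<Rightarrow> complex poly \<Rightarrow> bool" where
  "ratfun_irreducible p q \<longleftrightarrow> \<not> (\<exists>z. poly p z = 0 \<and> poly q z = 0)"

text \<open>At a pole the value is the junk value \<open>0\<close> of division by zero; in particular
  \<open>ratfun p q z = w\<close> with \<open>w \<noteq> 0\<close> entails that \<open>z\<close> is not a pole.\<close>

definition ratfun :: "complex poly \<Rightarrow> complex poly \<Rightarrow> complex \<Rightarrow> complex" where
  "ratfun p q z = poly p z / poly q z"

definition ratfun_poles :: "complex poly \<Rightarrow> complex poly \<Rightarrow> complex set" where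
  "ratfun_poles p q = {z. poly q z = 0}"

end

theory Submission
  imports Defs
begin

text \<open>
  Let \<open>p\<^sup>*\<close> and \<open>q\<^sup>*\<close> have the conjugated coefficients. On the real axis \<open>p p\<^sup>* - q q\<^sup>*\<close> equals
  \<open>|p|\<^sup>2 - |q|\<^sup>2\<close>, so it vanishes at the \<open>2 m - 1\<close> nodes; as its degree is at most \<open>2 m - 2\<close>, it
  is the zero polynomial. Hence \<open>|p| = |q|\<close> on the real axis, and a real pole would be a common
  zero of \<open>p\<close> and \<open>q\<close>.
\<close>

text \<open>A real point is its own conjugate, so conjugating the coefficients conjugates the value
  there, and the product has the form \<open>z * cnj z\<close>.\<close>

lemma poly_mult_map_poly_cnj_of_real:
  "poly (p * map_poly cnj p) (complex_of_real x) = complex_of_real ((cmod (poly p (complex_of_real x)))\<^sup>2)"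
  by (simp only: poly_mult poly_map_poly_cnj complex_cnj_complex_of_real complex_norm_square)

lemma degree_mult_map_poly_cnj_le:
  "degree (p * map_poly cnj p) \<le> 2 * degree p"
  using degree_mult_le[of p "map_poly cnj p"] map_poly_degree_leq[of cnj p] by linarith

lemma cmod_poly_eq_on_reals:
  fixes p q :: "complex poly" and S :: "real set"
  assumes "degree p \<le> n" "degree q \<le> n" and "finite S" "card S > 2 * n"
    and eq: "\<And>x. x \<in> S \<Longrightarrow> cmod (poly p (complex_of_real x)) = cmod (poly q (complex_of_real x))"
  shows "cmod (poly p (complex_of_real x)) = cmod (poly q (complex_of_real x))"
proof -
  define D where "D = p * map_poly cnj p - q * map_poly cnj q"
  have D: "poly D (complex_of_real y) = complex_of_real
      ((cmod (poly p (complex_of_real y)))\<^sup>2 - (cmod (poly q (complex_of_real y)))\<^sup>2)" for y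
    unfolding D_def poly_diff poly_mult_map_poly_cnj_of_real by simp
  have deg: "degree D \<le> 2 * n"
    unfolding D_def using assms(1,2) degree_mult_map_poly_cnj_le[of p] degree_mult_map_poly_cnj_le[of q]
    by (intro degree_diff_le) linarith+
  have "D = 0"
  proof (rule ccontr)
    assume "D \<noteq> 0"
    \<comment> \<open>The points of \<open>S\<close> would be more than \<open>2 * n\<close>
      distinct roots of \<open>D\<close>.\<close>
    have "card S = card (complex_of_real ` S)"
      by (simp add: card_image inj_on_def)
    also have "\<dots> \<le> card {z. poly D z = 0}"
      using \<open>D \<noteq> 0\<close> eq by (intro card_mono poly_roots_finite) (auto simp: D)
    also have "\<dots> \<le> degree D"
      using \<open>D \<noteq> 0\<close> by (rule card_poly_roots_bound)
    finally show False using deg assms(4) by linarith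
  qed
  then have "complex_of_real
      ((cmod (poly p (complex_of_real x)))\<^sup>2 - (cmod (poly q (complex_of_real x)))\<^sup>2) = 0"
    using D[of x] by simp
  then have "(cmod (poly p (complex_of_real x)))\<^sup>2 = (cmod (poly q (complex_of_real x)))\<^sup>2"
    unfolding of_real_eq_0_iff by simp
  then show ?thesis by (simp add: power2_eq_iff_nonneg)
qed

theorem proposition1:
  fixes m :: nat and p q :: "complex poly" and \<theta> :: "nat \<Rightarrow> real"
  assumes "m \<ge> 1"
    and "is_ratfun (m - 1) (m - 1) p q"
    and "ratfun_irreducible p q"
    and "inj_on \<theta> {1..2 * m - 1}"
    and "\<And>j. j \<in> {1..2 * m - 1} \<Longrightarrow>
           ratfun p q (complex_of_real (\<theta> j)) = exp (\<i> * complex_of_real (\<theta> j))"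
  shows "ratfun_poles p q \<inter> \<real> = {} \<and>
         (\<forall>x::real. cmod (ratfun p q (complex_of_real x)) = 1)"
proof -
  have node: "cmod (poly p (complex_of_real (\<theta> j))) = cmod (poly q (complex_of_real (\<theta> j)))"
    if "j \<in> {1..2 * m - 1}" for j
  proof -
    have "cmod (poly p (complex_of_real (\<theta> j)) / poly q (complex_of_real (\<theta> j))) = 1"
      using assms(5)[OF that] by (simp add: ratfun_def)
    \<comment> \<open>If \<open>q\<close> vanished at the node, the quotient would be 0 by the
      convention for division by zero, and its modulus could not be 1.\<close>
    then show ?thesis
      by (cases "poly q (complex_of_real (\<theta> j)) = 0") (simp_all add: norm_divide)
  qed
  have eq: "cmod (poly p (complex_of_real x)) = cmod (poly q (complex_of_real x))" for x
  proof (rule cmod_poly_eq_on_reals[where n = "m - 1" and S = "\<theta> ` {1..2 * m - 1}"])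
    \<comment> \<open>The count \<open>2 * m - 1\<close> exceeds the degree bound by exactly one.
      Subtraction is truncated, so this needs \<open>m \<ge> 1\<close>.\<close>
    show "2 * (m - 1) < card (\<theta> ` {1..2 * m - 1})"
      using assms(1) card_image[OF assms(4)] by simp
  qed (use assms(2) node in \<open>auto simp: is_ratfun_def\<close>)
  have q: "poly q (complex_of_real x) \<noteq> 0" for x
    using eq[of x] assms(3) by (auto simp: ratfun_irreducible_def)
  \<comment> \<open>Nonvanishing of \<open>q\<close> is used twice: it excludes real poles, and it
    makes the quotient of equal moduli 1 instead of the default 0.\<close>
  then show ?thesis
    using eq by (auto simp: ratfun_poles_def ratfun_def norm_divide elim!: Reals_cases)
qed

end
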